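(* Let $(A,\cdot,[\cdot,\cdot],D)$ be a finite-dimensional generalized Poisson algebra over $\Bbbk$. Define $x\circ y=x\cdot D(y)$ for $x,y\in A$. Then $(A,\circ,[\cdot,\cdot])$ is a special GD algebra.
   Context: $\Bbbk$ is an algebraically closed field of characteristic $0$. A generalized Poisson algebra is a tuple $(A,\cdot,[\cdot,\cdot],D)$ where $(A,\cdot)$ is a commutative associative algebra, $(A,[\cdot,\cdot])$ is a Lie algebra, $D$ is a derivation of both $(A,\cdot)$ and $(A,[\cdot,\cdot])$, and $[x\cdot y,z]=x\cdot[y,z]+[x,z]\cdot y+x\cdot y\cdot D(z)$ for all $x,y,z\in A$. A Novikov algebra is a vector space with a bilinear product $\circ$ satisfying $(x\circ y)\circ z-x\circ(y\circ z)=(y\circ x)\circ z-y\circ(x\circ z)$ and $(x\circ y)\circ z=(x\circ z)\circ y$. A Gelfand--Dorfman (GD) algebra is a triple $(A,\circ,[\cdot,\cdot])$ such that $(A,\circ)$ is a Novikov algebra, $(A,[\cdot,\cdot])$ is a Lie algebra, and for all $x,y,z\in A$: $[x,y\circ z]-[z,y\circ x]+[y,x]\circ z-[y,z]\circ x-y\circ[x,z]=0$. A differential Poisson algebra $(P,\cdot,\{\cdot,\cdot\},d)$ is a Poisson algebra (with commutative associative product $\cdot$; not required to be finite-dimensional) with a linear map $d$ that is a derivation of both $\cdot$ and $\{\cdot,\cdot\}$. It induces a GD algebra $P^{(d)}$ on $P$ by $[u,v]=\{u,v\}$, $u\circ v=u\cdot d(v)$. A GD algebra is special if it is isomorphic to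 a GD subalgebra of $P^{(d)}$ for some differential Poisson algebra $P$. *)

theory Defs
  imports
    "HOL-Computational_Algebra.Computational_Algebra"
    "HOL-Library.Function_Algebras"
begin

text \<open>
  An algebra is a whole type with a vector space structure \<open>scale\<close> over a field type and bilinear
  operations. Associative algebras are not assumed to be unital.
\<close>

locale bilinear_op = vector_space scale
  for scale :: "'k::field \<Rightarrow> 'v::ab_group_add \<Rightarrow> 'v" +
  fixes bop :: "'v \<Rightarrow> 'v \<Rightarrow> 'v"
  assumes linear_left: "Vector_Spaces.linear scale scale (\<lambda>x. bop x y)"
    and linear_right: "Vector_Spaces.linear scale scale (\<lambda>y. bop x y)"

locale commutative_algebra = bilinear_op scale mul
  for scale :: "'k::field \<Rightarrow> 'v::ab_group_add \<Rightarrow> 'v" and mul +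
  assumes mult_assoc: "mul (mul x y) z = mul x (mul y z)"
    and mult_comm: "mul x y = mul y x"

locale lie_algebra = bilinear_op scale br
  for scale :: "'k::field \<Rightarrow> 'v::ab_group_add \<Rightarrow> 'v" and br +
  assumes alternating: "br x x = 0"
    and jacobi: "br x (br y z) + br y (br z x) + br z (br x y) = 0"

definition derivation ::
    "('k::field \<Rightarrow> 'v::ab_group_add \<Rightarrow> 'v) \<Rightarrow> ('v \<Rightarrow> 'v \<Rightarrow> 'v) \<Rightarrow> ('v \<Rightarrow> 'v) \<Rightarrow> bool" where
  "derivation scale bop d \<longleftrightarrow>
     Vector_Spaces.linear scale scale d \<and>
     (\<forall>x y. d (bop x y) = bop (d x) y + bop x (d y))"

locale generalized_poisson_algebra =
  commutative_algebra scale mul + lie: lie_algebra scale br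
  for scale :: "'k::field \<Rightarrow> 'v::ab_group_add \<Rightarrow> 'v" and mul and br +
  fixes D :: "'v \<Rightarrow> 'v"
  assumes derivation_mult: "derivation scale mul D"
    and derivation_br: "derivation scale br D"
    and generalized_leibniz:
      "br (mul x y) z = mul x (br y z) + mul (br x z) y + mul (mul x y) (D z)"

locale poisson_algebra =
  commutative_algebra scale mul + lie: lie_algebra scale br
  for scale :: "'k::field \<Rightarrow> 'v::ab_group_add \<Rightarrow> 'v" and mul and br +
  assumes leibniz: "br (mul x y) z = mul x (br y z) + mul (br x z) y"

locale differential_poisson_algebra = poisson_algebra scale mul br
  for scale :: "'k::field \<Rightarrow> 'v::ab_group_add \<Rightarrow> 'v" and mul and br +
  fixes d :: "'v \<Rightarrow> 'v"
  assumes derivation_mult: "derivation scale mul d"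
    and derivation_br: "derivation scale br d"

locale novikov_algebra = bilinear_op scale nov
  for scale :: "'k::field \<Rightarrow> 'v::ab_group_add \<Rightarrow> 'v" and nov +
  assumes left_symmetric:
      "nov (nov x y) z - nov x (nov y z) = nov (nov y x) z - nov y (nov x z)"
    and right_commutative: "nov (nov x y) z = nov (nov x z) y"

locale gd_algebra =
  novikov_algebra scale nov + lie: lie_algebra scale br
  for scale :: "'k::field \<Rightarrow> 'v::ab_group_add \<Rightarrow> 'v" and nov and br +
  assumes gd_compatible:
    "br x (nov y z) - br z (nov y x) + nov (br y x) z - nov (br y z) x - nov y (br x z) = 0"

definition gd_subalgebra ::
    "('k::field \<Rightarrow> 'v::ab_group_add \<Rightarrow> 'v) \<Rightarrow> ('v \<Rightarrow> 'v \<Rightarrow> 'v) \<Rightarrow> ('v \<Rightarrow> 'v \<Rightarrow> 'v) \<Rightarrow> 'v set \<Rightarrow> bool" where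
  "gd_subalgebra scale nov br S \<longleftrightarrow>
     module.subspace scale S \<and> (\<forall>x\<in>S. \<forall>y\<in>S. nov x y \<in> S \<and> br x y \<in> S)"

definition gd_isomorphism_onto ::
    "('k::field \<Rightarrow> 'a::ab_group_add \<Rightarrow> 'a) \<Rightarrow> ('a \<Rightarrow> 'a \<Rightarrow> 'a) \<Rightarrow> ('a \<Rightarrow> 'a \<Rightarrow> 'a) \<Rightarrow>
     ('k \<Rightarrow> 'p::ab_group_add \<Rightarrow> 'p) \<Rightarrow> ('p \<Rightarrow> 'p \<Rightarrow> 'p) \<Rightarrow> ('p \<Rightarrow> 'p \<Rightarrow> 'p) \<Rightarrow>
     'p set \<Rightarrow> ('a \<Rightarrow> 'p) \<Rightarrow> bool" where
  "gd_isomorphism_onto scaleA novA brA scaleP novP brP S \<phi> \<longleftrightarrow>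
     Vector_Spaces.linear scaleA scaleP \<phi> \<and> bij_betw \<phi> UNIV S \<and>
     (\<forall>x y. \<phi> (novA x y) = novP (\<phi> x) (\<phi> y)) \<and>
     (\<forall>x y. \<phi> (brA x y) = brP (\<phi> x) (\<phi> y))"

definition induced_nov :: "('v \<Rightarrow> 'v \<Rightarrow> 'v) \<Rightarrow> ('v \<Rightarrow> 'v) \<Rightarrow> 'v \<Rightarrow> 'v \<Rightarrow> 'v" where
  "induced_nov mul d = (\<lambda>u v. mul u (d v))"

text \<open>
  HOL cannot quantify existentially over types, so the differential Poisson algebra \<open>P\<close> in the
  definition of a special GD algebra \<open>A\<close> has to live on a fixed type. We take the space of all
  \<open>'k\<close>-valued functions on the set of formal expressions in the operations of \<open>P\<close> with generators
  from \<open>A\<close>. This is no restriction: the subalgebra of \<open>P\<close> generated by the image of \<open>A\<close> is spanned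
  by the values of such expressions. The lemma \<open>special_gd_algebraI\<close> below makes this precise:
  a GD algebra is special as soon as it embeds into the GD algebra induced by a differential
  Poisson algebra on any type whatsoever.
\<close>

datatype 'a dp_term =
    DP_Gen 'a
  | DP_Mult "'a dp_term" "'a dp_term"
  | DP_Br "'a dp_term" "'a dp_term"
  | DP_Der "'a dp_term"

definition fun_scale :: "'k::field \<Rightarrow> ('i \<Rightarrow> 'k) \<Rightarrow> 'i \<Rightarrow> 'k" where
  "fun_scale c f = (\<lambda>i. c * f i)"

definition special_gd_algebra ::
    "('k::field \<Rightarrow> 'a::ab_group_add \<Rightarrow> 'a) \<Rightarrow> ('a \<Rightarrow> 'a \<Rightarrow> 'a) \<Rightarrow> ('a \<Rightarrow> 'a \<Rightarrow> 'a) \<Rightarrow> bool" where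
  "special_gd_algebra scale nov br \<longleftrightarrow>
     gd_algebra scale nov br \<and>
     (\<exists>(mulP :: ('a dp_term \<Rightarrow> 'k) \<Rightarrow> _) brP d S \<phi>.
        differential_poisson_algebra fun_scale mulP brP d \<and>
        gd_subalgebra fun_scale (induced_nov mulP d) brP S \<and>
        gd_isomorphism_onto scale nov br fun_scale (induced_nov mulP d) brP S \<phi>)"

lemma vector_space_fun_scale:
  "vector_space (fun_scale :: 'k::field \<Rightarrow> ('i \<Rightarrow> 'k) \<Rightarrow> 'i \<Rightarrow> 'k)"
  by unfold_locales (auto simp: fun_scale_def fun_eq_iff algebra_simps)

lemma (in bilinear_op) bop_add_left: "bop (x + y) z = bop x z + bop y z"
  and bop_scale_left: "bop (scale c x) z = scale c (bop x z)"
  and bop_neg_left: "bop (- x) z = - bop x z"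
proof -
  interpret l: Vector_Spaces.linear scale scale "\<lambda>x. bop x z" by (rule linear_left)
  show "bop (x + y) z = bop x z + bop y z" by (rule l.add)
  show "bop (scale c x) z = scale c (bop x z)" by (rule l.scale)
  show "bop (- x) z = - bop x z" by (rule l.neg)
qed

lemma (in bilinear_op) bop_add_right: "bop z (x + y) = bop z x + bop z y"
  and bop_scale_right: "bop z (scale c x) = scale c (bop z x)"
  and bop_neg_right: "bop z (- x) = - bop z x"
proof -
  interpret r: Vector_Spaces.linear scale scale "bop z" by (rule linear_right)
  show "bop z (x + y) = bop z x + bop z y" by (rule r.add)
  show "bop z (scale c x) = scale c (bop z x)" by (rule r.scale)
  show "bop z (- x) = - bop z x" by (rule r.neg)
qed

lemma (in differential_poisson_algebra) gd_algebra_induced: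
  "gd_algebra scale (induced_nov mul d) br"
proof -
  have ld: "Vector_Spaces.linear scale scale d"
    and dm: "d (mul x y) = mul (d x) y + mul x (d y)"
    and db: "d (br x y) = br (d x) y + br x (d y)" for x y
    using derivation_mult derivation_br unfolding derivation_def by auto
  note add_l = bop_add_left and add_r = bop_add_right
    and badd_l = lie.bop_add_left and badd_r = lie.bop_add_right
    and mneg_l = bop_neg_left and mneg_r = bop_neg_right
  have anti: "br x y = - br y x" for x y
  proof -
    have "br (x + y) (x + y) = br x y + br y x"
      unfolding badd_l badd_r by (simp add: lie.alternating)
    then show ?thesis by (simp add: lie.alternating eq_neg_iff_add_eq_0)
  qed
  have lc: "mul x (mul y z) = mul y (mul x z)" for x y z
    by (metis mult_assoc mult_comm)
  note ac = mult_assoc mult_comm lc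
  have br_right: "br z (mul x y) = mul x (br z y) + mul (br z x) y" for x y z
    using anti[of z "mul x y"] anti[of z x] anti[of z y]
    by (simp add: leibniz mneg_l mneg_r)
  show ?thesis
  proof (intro gd_algebra.intro novikov_algebra.intro bilinear_op.intro
      bilinear_op_axioms.intro novikov_algebra_axioms.intro gd_algebra_axioms.intro)
    fix y show "Vector_Spaces.linear scale scale (\<lambda>x. induced_nov mul d x y)"
      unfolding induced_nov_def by (rule linear_left)
  next
    fix x show "Vector_Spaces.linear scale scale (induced_nov mul d x)"
      unfolding induced_nov_def
      using Vector_Spaces.linear_compose[OF ld linear_right[of x]] by (simp add: o_def)
  next
    fix x y z
    show "induced_nov mul d (induced_nov mul d x y) z - induced_nov mul d x (induced_nov mul d y z) =
       induced_nov mul d (induced_nov mul d y x) z - induced_nov mul d y (induced_nov mul d x z)"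
      unfolding induced_nov_def by (simp add: dm add_l add_r ac)
    show "induced_nov mul d (induced_nov mul d x y) z = induced_nov mul d (induced_nov mul d x z) y"
      unfolding induced_nov_def by (simp add: ac)
    show "br x (induced_nov mul d y z) - br z (induced_nov mul d y x) + induced_nov mul d (br y x) z
        - induced_nov mul d (br y z) x - induced_nov mul d y (br x z) = 0"
      unfolding induced_nov_def
      using anti[of y x] anti[of y z] anti[of "d x" z]
        add_r[of y "br x (d z)" "- br z (d x)"]
      by (simp add: br_right db add_r add_l mneg_l mneg_r)
  qed (rule vector_space_axioms lie.lie_algebra_axioms)+
qed

lemma (in bilinear_op) span_closed:
  assumes "\<And>x y. x \<in> X \<Longrightarrow> y \<in> X \<Longrightarrow> bop x y \<in> span X"
    and x: "x \<in> span X" and y: "y \<in> span X"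
  shows "bop x y \<in> span X"
proof -
  have "bop a y \<in> span X" if a: "a \<in> X" for a
  proof -
    interpret r: Vector_Spaces.linear scale scale "bop a" by (rule linear_right)
    show ?thesis
      using y by (induction rule: span_induct_alt)
        (use assms(1) a in \<open>auto simp: r.add r.scale intro: span_add span_scale span_zero\<close>)
  qed
  moreover interpret l: Vector_Spaces.linear scale scale "\<lambda>x. bop x y" by (rule linear_left)
  show ?thesis
    using x by (induction rule: span_induct_alt)
      (use calculation in \<open>auto simp: l.add l.scale intro: span_add span_scale span_zero\<close>)
qed

primrec dp_eval :: "('p \<Rightarrow> 'p \<Rightarrow> 'p) \<Rightarrow> ('p \<Rightarrow> 'p \<Rightarrow> 'p) \<Rightarrow> ('p \<Rightarrow> 'p) \<Rightarrow> ('a \<Rightarrow> 'p) \<Rightarrow> 'a dp_term \<Rightarrow> 'p" where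
  "dp_eval m b d \<phi> (DP_Gen a) = \<phi> a"
| "dp_eval m b d \<phi> (DP_Mult s t) = m (dp_eval m b d \<phi> s) (dp_eval m b d \<phi> t)"
| "dp_eval m b d \<phi> (DP_Br s t) = b (dp_eval m b d \<phi> s) (dp_eval m b d \<phi> t)"
| "dp_eval m b d \<phi> (DP_Der t) = d (dp_eval m b d \<phi> t)"

lemma special_gd_algebraI:
  fixes scale :: "'k::field \<Rightarrow> 'a::ab_group_add \<Rightarrow> 'a"
    and scaleP :: "'k \<Rightarrow> 'p::ab_group_add \<Rightarrow> 'p"
  assumes gd: "gd_algebra scale nov br"
    and P: "differential_poisson_algebra scaleP mulP brP d"
    and lin: "Vector_Spaces.linear scale scaleP \<phi>" and inj: "inj \<phi>"
    and nov: "\<And>x y. \<phi> (nov x y) = mulP (\<phi> x) (d (\<phi> y))"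
    and br: "\<And>x y. \<phi> (br x y) = brP (\<phi> x) (\<phi> y)"
  shows "special_gd_algebra scale nov br"
proof -
  interpret P: differential_poisson_algebra scaleP mulP brP d by (rule P)
  interpret W: vector_space "fun_scale :: 'k \<Rightarrow> ('a dp_term \<Rightarrow> 'k) \<Rightarrow> _"
    by (rule vector_space_fun_scale)
  interpret PW: vector_space_pair scaleP "fun_scale :: 'k \<Rightarrow> ('a dp_term \<Rightarrow> 'k) \<Rightarrow> _"
    by unfold_locales
  define ev where "ev = dp_eval mulP brP d \<phi>"
  define U where "U = P.span (range ev)"
  have ld: "Vector_Spaces.linear scaleP scaleP d"
    and dm: "d (mulP x y) = mulP (d x) y + mulP x (d y)"
    and db: "d (brP x y) = brP (d x) y + brP x (d y)" for x y
    using P.derivation_mult P.derivation_br unfolding derivation_def by auto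
  interpret ld: Vector_Spaces.linear scaleP scaleP d by (rule ld)
  have phiU: "\<phi> a \<in> U" for a
    unfolding U_def ev_def by (rule P.span_base) (metis dp_eval.simps(1) rangeI)
  have mU: "mulP x y \<in> U" if "x \<in> U" "y \<in> U" for x y
    using that unfolding U_def ev_def
    by (rule P.span_closed[rotated]) (auto intro!: P.span_base, metis dp_eval.simps(2) rangeI)
  have bU: "brP x y \<in> U" if "x \<in> U" "y \<in> U" for x y
    using that unfolding U_def ev_def
    by (rule P.lie.span_closed[rotated]) (auto intro!: P.span_base, metis dp_eval.simps(3) rangeI)
  have dU: "d x \<in> U" if "x \<in> U" for x
  proof -
    have ev: "d (ev t) \<in> P.span (range ev)" for t
      unfolding ev_def by (rule P.span_base) (metis dp_eval.simps(4) rangeI)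
    show ?thesis
      using that unfolding U_def
    proof (induction rule: P.span_induct_alt)
      case base
      show ?case by (simp add: P.span_zero ld.zero)
    next
      case (step c x y)
      then obtain t where "x = ev t" by auto
      with ev[of t] step show ?case
        by (simp add: ld.add ld.scale P.span_add P.span_scale)
    qed
  qed
  obtain B where B: "B \<subseteq> range ev" "P.independent B" "range ev \<subseteq> P.span B"
    using P.maximal_independent_subset by blast
  have spanB: "P.span B = U"
    unfolding U_def using B(1,3) by (metis P.span_eq P.span_superset subset_trans)
  define E where "E = P.extend_basis B"
  have E: "B \<subseteq> E" "P.independent E" "P.span E = UNIV"
    unfolding E_def using P.extend_basis_superset B(2) P.independent_extend_basis P.span_extend_basis
    by auto
  define \<iota> where "\<iota> p = (\<lambda>t. P.representation E p (ev t))" for p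
  have lin_i: "Vector_Spaces.linear scaleP fun_scale \<iota>"
    by unfold_locales
      (auto simp: \<iota>_def fun_eq_iff fun_scale_def P.representation_add P.representation_scale E)
  interpret i: Vector_Spaces.linear scaleP fun_scale \<iota> by (rule lin_i)
  have inj_i: "inj_on \<iota> U"
  proof (rule inj_onI)
    fix x y assume xy: "x \<in> U" "y \<in> U" "\<iota> x = \<iota> y"
    have outside: "P.representation E z e = 0" if "z \<in> U" "e \<notin> B" for z e
      using that P.representation_extend[OF E(2) _ E(1), of z] P.representation_ne_zero[of B z e]
      by (auto simp: spanB)
    have "P.representation E x e = P.representation E y e" for e
    proof (cases "e \<in> B")
      case True
      then obtain t where "e = ev t" using B by auto
      then show ?thesis using xy(3) unfolding \<iota>_def by metis
    qed (use outside xy in auto)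
    then have "P.representation E x = P.representation E y" by auto
    then show "x = y"
      by (metis E(2,3) P.sum_nonzero_representation_eq UNIV_I)
  qed
  have spanU: "P.span U = U" unfolding U_def by (rule P.span_span)
  obtain \<psi> where \<psi>: "\<psi> ` UNIV \<subseteq> U" "Vector_Spaces.linear fun_scale scaleP \<psi>"
      "\<And>x. x \<in> U \<Longrightarrow> \<psi> (\<iota> x) = x"
    using PW.linear_exists_left_inverse_on[OF lin_i, of U] inj_i spanU
    by (metis P.subspace_span)
  interpret p: Vector_Spaces.linear fun_scale scaleP \<psi> by (rule \<psi>(2))
  have psiU: "\<psi> w \<in> U" for w using \<psi>(1) by auto
  define mW where "mW f g = \<iota> (mulP (\<psi> f) (\<psi> g))" for f g
  define bW where "bW f g = \<iota> (brP (\<psi> f) (\<psi> g))" for f g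
  define dW where "dW f = \<iota> (d (\<psi> f))" for f
  note add_m = P.bop_add_left P.bop_add_right P.bop_scale_left P.bop_scale_right
  note add_b = P.lie.bop_add_left P.lie.bop_add_right P.lie.bop_scale_left P.lie.bop_scale_right
  note hom = p.add p.scale i.add i.scale ld.add ld.scale add_m add_b
  note inU = psiU mU bU dU
  have W: "differential_poisson_algebra fun_scale mW bW dW"
  proof unfold_locales
    show "derivation fun_scale mW dW"
      unfolding derivation_def
      by (intro conjI allI, unfold_locales)
        (auto simp: mW_def dW_def hom \<psi>(3) inU dm)
    show "derivation fun_scale bW dW"
      unfolding derivation_def
      by (intro conjI allI, unfold_locales)
        (auto simp: bW_def dW_def hom \<psi>(3) inU db)
  next
    fix x y z
    show "mW (mW x y) z = mW x (mW y z)"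
      by (simp add: mW_def \<psi>(3) inU P.mult_assoc)
    show "mW x y = mW y x"
      by (simp add: mW_def P.mult_comm[of "\<psi> x"])
    show "bW x x = 0"
      by (simp add: bW_def P.lie.alternating i.zero)
    show "bW x (bW y z) + bW y (bW z x) + bW z (bW x y) = 0"
      by (simp add: bW_def \<psi>(3) inU flip: i.add) (simp add: P.lie.jacobi i.zero)
    show "bW (mW x y) z = mW x (bW y z) + mW (bW x z) y"
      by (simp add: bW_def mW_def \<psi>(3) inU P.leibniz flip: i.add)
  qed (auto simp: mW_def bW_def hom)
  define \<theta> where "\<theta> = \<iota> \<circ> \<phi>"
  have lin_t: "Vector_Spaces.linear scale fun_scale \<theta>"
    unfolding \<theta>_def using lin lin_i by (rule Vector_Spaces.linear_compose)
  interpret t: Vector_Spaces.linear scale fun_scale \<theta> by (rule lin_t)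
  have t_nov: "\<theta> (nov x y) = induced_nov mW dW (\<theta> x) (\<theta> y)" for x y
    by (simp add: \<theta>_def induced_nov_def mW_def dW_def \<psi>(3) inU phiU nov)
  have t_br: "\<theta> (br x y) = bW (\<theta> x) (\<theta> y)" for x y
    by (simp add: \<theta>_def bW_def \<psi>(3) inU phiU br)
  have "inj \<theta>"
    unfolding \<theta>_def using inj inj_i phiU by (metis comp_inj_on image_subsetI inj_on_subset)
  then have "gd_isomorphism_onto scale nov br fun_scale (induced_nov mW dW) bW (range \<theta>) \<theta>"
    unfolding gd_isomorphism_onto_def using lin_t t_nov t_br by (auto simp: bij_betw_def)
  moreover have "gd_subalgebra fun_scale (induced_nov mW dW) bW (range \<theta>)"
    unfolding gd_subalgebra_def
    by (auto simp: t.subspace_image simp flip: t_nov t_br)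
  ultimately show ?thesis
    unfolding special_gd_algebra_def using gd W by blast
qed

end

theory Submission
  imports Defs "HOL-Library.Poly_Mapping"
begin

text \<open>
  The idea is to turn the generalized Poisson bracket into an honest Poisson bracket by adjoining
  an invertible variable \<open>t\<close>. On \<open>P = A[t, 1/t]\<close> the goal is a Poisson bracket, homogeneous of
  degree \<open>-1\<close>, with \<open>{a t, b t} = [a, b] t\<close>. If \<open>A\<close> has a unit, then the generalized
  Leibniz rule gives \<open>[1, b] = - D b\<close>, so \<open>{t, b} = - D b\<close>, and the Leibniz rule forces
    \<open>{a t^(p+1), b t^(q+1)} = ([a, b] - p a D(b) + q D(a) b) t^(p+q+1)\<close>.
  This formula makes sense without a unit. The term \<open>x y D(z)\<close> in the generalized Leibniz rule is
  absorbed by the shift \<open>p + q + 1\<close> in the weight of a product (\<open>wbr_leibniz\<close>), and the Jacobi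
  identity holds for the corrected bracket as well (\<open>wbr_jacobi\<close>).

  The derivation of \<open>P\<close> is \<open>d(a t^(p+1)) = D(a) t^p\<close>. Formally it is \<open>- {log t, -}\<close>, a Hamiltonian
  vector field, which explains why it respects the bracket (\<open>wbr_derivation\<close> is the direct check).
  The map \<open>a \<mapsto> a t\<close> then embeds \<open>A\<close> into the GD algebra of \<open>P\<close>: it preserves the bracket because
  both correction terms vanish for \<open>p = q = 0\<close>, and \<open>(a t) d(b t) = a D(b) t\<close>. Specialness follows
  from the criterion \<open>special_gd_algebraI\<close>.

  Laurent polynomials are encoded as finitely supported functions from the integers to \<open>A\<close>, where
  \<open>single p a\<close> stands for \<open>a t^(p+1)\<close>. With this shift the embedding is \<open>single 0\<close>, the bracket adds
  weights, the product adds them and one more, and \<open>d\<close> lowers the weight by one. All operations are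
  additive in each argument, so each identity on \<open>P\<close> reduces to homogeneous elements, that is, to a
  weighted identity in \<open>A\<close>.
\<close>

section \<open>Additive maps on finitely supported functions\<close>

definition additive_ext :: "('i \<Rightarrow> 'a \<Rightarrow> 'b) \<Rightarrow> ('i \<Rightarrow>\<^sub>0 'a::ab_group_add) \<Rightarrow> 'b::ab_group_add" where
  "additive_ext F f = (\<Sum>i\<in>Poly_Mapping.keys f. F i (Poly_Mapping.lookup f i))"

lemma additive_ext_add:
  assumes "\<And>i. additive (F i)"
  shows "additive_ext F (f + g) = additive_ext F f + additive_ext F g"
proof -
  have superset: "additive_ext F h
      = (\<Sum>i\<in>Poly_Mapping.keys f \<union> Poly_Mapping.keys g. F i (Poly_Mapping.lookup h i))"
    if "Poly_Mapping.keys h \<subseteq> Poly_Mapping.keys f \<union> Poly_Mapping.keys g" for h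
    unfolding additive_ext_def using that
    by (intro sum.mono_neutral_left) (auto simp: in_keys_iff additive.zero[OF assms])
  show ?thesis
    by (simp add: superset keys_add lookup_add additive.add[OF assms] sum.distrib)
qed

lemma additive_ext_single:
  assumes "F i 0 = 0"
  shows "additive_ext F (Poly_Mapping.single i a) = F i a"
  using assms by (simp add: additive_ext_def)

lemma additive_ext_add_fun:
  "additive_ext (\<lambda>i a. F i a + G i a) f = additive_ext F f + additive_ext G f"
  by (simp add: additive_ext_def sum.distrib)

lemma poly_mapping_additive_induct [case_names single add]:
  fixes f :: "'i \<Rightarrow>\<^sub>0 'a::ab_group_add"
  assumes single: "\<And>i a. P (Poly_Mapping.single i a)"
    and add: "\<And>f g. P f \<Longrightarrow> P g \<Longrightarrow> P (f + g)"
  shows "P f"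
proof (induction f rule: update_induct)
  case const
  show ?case using single[of undefined 0] by simp
next
  case (update f i a)
  then have "Poly_Mapping.update i a f = Poly_Mapping.single i a + f"
    by (intro poly_mapping_eqI) (auto simp: lookup_update lookup_add lookup_single in_keys_iff)
  with update single add show ?case by metis
qed

text \<open>
  The biadditive operation on finitely supported functions that sends components of weights \<open>p\<close> and
  \<open>q\<close> to weight \<open>w p q\<close>. The operation \<open>\<beta>\<close> on components may depend on the weights, as the
  bracket below requires.
\<close>

definition graded_op ::
    "(int \<Rightarrow> int \<Rightarrow> int) \<Rightarrow> (int \<Rightarrow> int \<Rightarrow> 'a \<Rightarrow> 'a \<Rightarrow> 'a::ab_group_add)
      \<Rightarrow> (int \<Rightarrow>\<^sub>0 'a) \<Rightarrow> (int \<Rightarrow>\<^sub>0 'a) \<Rightarrow> (int \<Rightarrow>\<^sub>0 'a)" where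
  "graded_op w \<beta> f g =
     additive_ext (\<lambda>p a. additive_ext (\<lambda>q b. Poly_Mapping.single (w p q) (\<beta> p q a b)) g) f"

context
  fixes \<beta> :: "int \<Rightarrow> int \<Rightarrow> 'a \<Rightarrow> 'a \<Rightarrow> 'a::ab_group_add"
  assumes add_l: "\<And>p q a a' b. \<beta> p q (a + a') b = \<beta> p q a b + \<beta> p q a' b"
    and add_r: "\<And>p q a b b'. \<beta> p q a (b + b') = \<beta> p q a b + \<beta> p q a b'"
begin

lemma graded_op_add:
  shows "graded_op w \<beta> (f + f') g = graded_op w \<beta> f g + graded_op w \<beta> f' g"
    and "graded_op w \<beta> f (g + g') = graded_op w \<beta> f g + graded_op w \<beta> f g'"
proof -
  have r: "additive (\<lambda>b. Poly_Mapping.single (w p q) (\<beta> p q a b))" for p q a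
    by unfold_locales (simp add: add_r single_add)
  have l: "additive (\<lambda>a. additive_ext (\<lambda>q b. Poly_Mapping.single (w p q) (\<beta> p q a b)) g)" for p g
    by unfold_locales (simp add: add_l single_add additive_ext_add_fun)
  show "graded_op w \<beta> (f + f') g = graded_op w \<beta> f g + graded_op w \<beta> f' g"
    unfolding graded_op_def by (rule additive_ext_add) (rule l)
  show "graded_op w \<beta> f (g + g') = graded_op w \<beta> f g + graded_op w \<beta> f g'"
    unfolding graded_op_def by (simp add: additive_ext_add[OF r] additive_ext_add_fun)
qed

lemma graded_op_single:
  "graded_op w \<beta> (Poly_Mapping.single p a) (Poly_Mapping.single q b)
     = Poly_Mapping.single (w p q) (\<beta> p q a b)"
proof -
  have "\<beta> p q 0 b = 0" "\<beta> p q a 0 = 0" for p q a b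
    using add_l[of p q 0 0 b] add_r[of p q a 0 0] by simp_all
  then show ?thesis
    by (simp add: graded_op_def additive_ext_single)
qed

end

section \<open>The bracket of weighted elements\<close>

context generalized_poisson_algebra
begin

lemma linear_D: "Vector_Spaces.linear scale scale D"
  and D_mul: "D (mul x y) = mul (D x) y + mul x (D y)"
  and D_br: "D (br x y) = br (D x) y + br x (D y)"
  using derivation_mult derivation_br unfolding derivation_def by auto

sublocale D: Vector_Spaces.linear scale scale D
  by (rule linear_D)

lemma br_antisym: "br y x = - br x y"
proof -
  have "br (x + y) (x + y) = br x y + br y x"
    unfolding lie.bop_add_left lie.bop_add_right by (simp add: lie.alternating)
  then show ?thesis by (simp add: lie.alternating eq_neg_iff_add_eq_0 add.commute)
qed

lemma mul_diff: "mul (x - y) z = mul x z - mul y z" "mul z (x - y) = mul z x - mul z y"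
  and br_diff: "br (x - y) z = br x z - br y z" "br z (x - y) = br z x - br z y"
  using bop_add_left[of x "- y"] bop_add_right[of z x "- y"]
    lie.bop_add_left[of x "- y"] lie.bop_add_right[of z x "- y"]
  by (simp_all add: bop_neg_left bop_neg_right lie.bop_neg_left lie.bop_neg_right)

lemma mult_left_comm: "mul x (mul y z) = mul y (mul x z)"
  by (metis mult_assoc mult_comm)

lemma br_mul_right: "br z (mul x y) = mul x (br z y) + mul (br z x) y - mul (mul x y) (D z)"
proof -
  have "br z (mul x y) = - br (mul x y) z" by (rule br_antisym)
  then show ?thesis
    by (simp add: generalized_leibniz br_antisym[of y z] br_antisym[of x z] bop_neg_left bop_neg_right)
qed

text \<open>
  The coefficient of the bracket of \<open>a t^(p+1)\<close> and \<open>b t^(q+1)\<close>. The weights range over the field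
  since the identities are polynomial in them.
\<close>

definition wbr :: "'k \<Rightarrow> 'k \<Rightarrow> 'v \<Rightarrow> 'v \<Rightarrow> 'v" where
  "wbr p q a b = br a b - scale p (mul a (D b)) + scale q (mul (D a) b)"

lemmas multilinear_expand =
  bop_add_left bop_add_right bop_scale_left bop_scale_right bop_neg_left bop_neg_right mul_diff
  lie.bop_add_left lie.bop_add_right lie.bop_scale_left lie.bop_scale_right
  lie.bop_neg_left lie.bop_neg_right br_diff
  D.add D.scale D.diff D.neg D_mul D_br
  scale_left_distrib scale_right_distrib scale_left_diff_distrib scale_right_diff_distrib
  scale_minus_left scale_minus_right

lemma wbr_antisym: "wbr q p b a = - wbr p q a b"
  by (simp add: wbr_def br_antisym[of b a] mult_comm[of b] mult_comm[of "D b"])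

text \<open>
  The bracket with \<open>c\<close> contributes \<open>a b D(c)\<close> with coefficient \<open>-(p + q)\<close> on the right, and
  \<open>-(p + q + 1)\<close> from the weight on the left. The extra unit cancels the anomalous term of the
  generalized Leibniz rule.
\<close>

lemma wbr_leibniz: "wbr (p + q + 1) r (mul a b) c = mul a (wbr q r b c) + mul (wbr p r a c) b"
  by (simp add: wbr_def multilinear_expand generalized_leibniz mult_assoc mult_comm mult_left_comm)

text \<open>
  Lowering the weights on the right costs \<open>D(a) D(b)\<close> once with each sign, so that only the Leibniz
  rules of \<open>D\<close> remain.
\<close>

lemma wbr_derivation: "D (wbr p q a b) = wbr (p - 1) q (D a) b + wbr p (q - 1) a (D b)"
  by (simp add: wbr_def multilinear_expand)

text \<open>
  Compare the coefficients of the weights. The constant part is the Jacobi identity of \<open>A\<close>. In the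
  linear part, the anomalous terms of the Leibniz rule, such as \<open>D(a) D(b) c\<close>, cancel in pairs, and
  the others cancel since \<open>D\<close> is a derivation of the bracket. In the quadratic part, the products
  \<open>D(a) D(b) c\<close> and \<open>D(D(a)) b c\<close> and their cyclic shifts occur with total coefficient zero.
\<close>

lemma wbr_jacobi:
  "wbr p (q + r) a (wbr q r b c) + wbr q (r + p) b (wbr r p c a) + wbr r (p + q) c (wbr p q a b) = 0"
proof -
  have "br a (br b c) = - br b (br c a) - br c (br a b)"
    using lie.jacobi[of a b c] by (simp add: eq_diff_eq eq_neg_iff_add_eq_0 ac_simps)
  \<comment> \<open>Antisymmetry is instantiated so that it terminates as a rewrite rule: it moves the
    derivative to the front and orders the pairs of letters as \<open>b a\<close>, \<open>a c\<close> and \<open>c b\<close>.\<close>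
  then show ?thesis
    by (simp add: wbr_def multilinear_expand br_mul_right
        br_antisym[of "D a" b] br_antisym[of "D a" c] br_antisym[of "D b" a]
        br_antisym[of "D b" c] br_antisym[of "D c" a] br_antisym[of "D c" b]
        br_antisym[of b a] br_antisym[of a c] br_antisym[of c b])
      (simp add: mult_assoc mult_comm mult_left_comm mult.commute distrib_left scale_left_distrib)
qed

lemma gd_algebra_derivation_product: "gd_algebra scale (\<lambda>x y. mul x (D y)) br"
proof unfold_locales
  fix x y z
  show "mul (mul x (D y)) (D z) - mul x (D (mul y (D z)))
      = mul (mul y (D x)) (D z) - mul y (D (mul x (D z)))"
    by (simp add: multilinear_expand mult_assoc mult_comm mult_left_comm)
  show "mul (mul x (D y)) (D z) = mul (mul x (D z)) (D y)"
    by (simp add: mult_assoc mult_comm mult_left_comm)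
  show "br x (mul y (D z)) - br z (mul y (D x)) + mul (br y x) (D z) - mul (br y z) (D x)
      - mul y (D (br x z)) = 0"
    by (simp add: multilinear_expand br_mul_right
        br_antisym[of y x] br_antisym[of y z] br_antisym[of "D x" z] mult_assoc mult_comm mult_left_comm)
qed (auto simp: multilinear_expand)

section \<open>The Poissonization\<close>

definition P_scale :: "'k \<Rightarrow> (int \<Rightarrow>\<^sub>0 'v) \<Rightarrow> (int \<Rightarrow>\<^sub>0 'v)" where
  "P_scale c = additive_ext (\<lambda>p a. Poly_Mapping.single p (scale c a))"

definition P_mul :: "(int \<Rightarrow>\<^sub>0 'v) \<Rightarrow> (int \<Rightarrow>\<^sub>0 'v) \<Rightarrow> (int \<Rightarrow>\<^sub>0 'v)" where
  "P_mul = graded_op (\<lambda>p q. p + q + 1) (\<lambda>p q. mul)"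

definition P_br :: "(int \<Rightarrow>\<^sub>0 'v) \<Rightarrow> (int \<Rightarrow>\<^sub>0 'v) \<Rightarrow> (int \<Rightarrow>\<^sub>0 'v)" where
  "P_br = graded_op (+) (\<lambda>p q. wbr (of_int p) (of_int q))"

definition P_der :: "(int \<Rightarrow>\<^sub>0 'v) \<Rightarrow> (int \<Rightarrow>\<^sub>0 'v)" where
  "P_der = additive_ext (\<lambda>p a. Poly_Mapping.single (p - 1) (D a))"

lemma P_scale_add: "P_scale c (f + g) = P_scale c f + P_scale c g"
  and P_scale_single: "P_scale c (Poly_Mapping.single p a) = Poly_Mapping.single p (scale c a)"
  unfolding P_scale_def
  by (intro additive_ext_add additive_ext_single; (unfold_locales)?;
      simp add: scale_right_distrib single_add)+

lemma P_der_add: "P_der (f + g) = P_der f + P_der g"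
  and P_der_single: "P_der (Poly_Mapping.single p a) = Poly_Mapping.single (p - 1) (D a)"
  unfolding P_der_def
  by (intro additive_ext_add additive_ext_single; (unfold_locales)?; simp add: D.add single_add)+

lemma P_mul_add: "P_mul (f + f') g = P_mul f g + P_mul f' g" "P_mul f (g + g') = P_mul f g + P_mul f g'"
  and P_mul_single: "P_mul (Poly_Mapping.single p a) (Poly_Mapping.single q b)
    = Poly_Mapping.single (p + q + 1) (mul a b)"
  unfolding P_mul_def
  by (simp_all add: graded_op_add graded_op_single bop_add_left bop_add_right)

lemma P_br_add: "P_br (f + f') g = P_br f g + P_br f' g" "P_br f (g + g') = P_br f g + P_br f g'"
  and P_br_single: "P_br (Poly_Mapping.single p a) (Poly_Mapping.single q b)
    = Poly_Mapping.single (p + q) (wbr (of_int p) (of_int q) a b)"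
proof -
  have l: "wbr p q (a + a') b = wbr p q a b + wbr p q a' b"
    and r: "wbr p q a (b + b') = wbr p q a b + wbr p q a b'" for p q a a' b b'
    by (simp_all add: wbr_def multilinear_expand)
  show "P_br (f + f') g = P_br f g + P_br f' g" "P_br f (g + g') = P_br f g + P_br f g'"
    "P_br (Poly_Mapping.single p a) (Poly_Mapping.single q b)
      = Poly_Mapping.single (p + q) (wbr (of_int p) (of_int q) a b)"
    unfolding P_br_def by (simp_all add: graded_op_add graded_op_single l r)
qed

lemmas P_add = P_scale_add P_der_add P_mul_add P_br_add
lemmas P_single = P_scale_single P_der_single P_mul_single P_br_single

lemma wbr_scale: "wbr p q (scale c a) b = scale c (wbr p q a b)"
  "wbr p q a (scale c b) = scale c (wbr p q a b)"
  by (simp_all add: wbr_def multilinear_expand mult.commute)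

lemma P_vector_space: "vector_space P_scale"
proof unfold_locales
  fix a b x y
  show "P_scale a (x + y) = P_scale a x + P_scale a y"
    by (rule P_scale_add)
  show "P_scale (a + b) x = P_scale a x + P_scale b x"
    by (induction x rule: poly_mapping_additive_induct)
      (simp_all add: P_add P_single scale_left_distrib single_add)
  show "P_scale a (P_scale b x) = P_scale (a * b) x"
    by (induction x rule: poly_mapping_additive_induct) (simp_all add: P_add P_single)
  show "P_scale 1 x = x"
    by (induction x rule: poly_mapping_additive_induct) (simp_all add: P_add P_single)
qed

lemma P_mul_scale: "P_mul (P_scale c x) y = P_scale c (P_mul x y)"
  "P_mul x (P_scale c y) = P_scale c (P_mul x y)"
proof -
  have "P_mul (P_scale c x) y = P_scale c (P_mul x y) \<and> P_mul x (P_scale c y) = P_scale c (P_mul x y)"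
  proof (induction x rule: poly_mapping_additive_induct)
    case (single p a)
    show ?case
      by (induction y rule: poly_mapping_additive_induct)
        (simp_all add: P_add P_single bop_scale_left bop_scale_right)
  qed (simp add: P_add)
  then show "P_mul (P_scale c x) y = P_scale c (P_mul x y)" "P_mul x (P_scale c y) = P_scale c (P_mul x y)"
    by auto
qed

lemma P_br_scale: "P_br (P_scale c x) y = P_scale c (P_br x y)"
  "P_br x (P_scale c y) = P_scale c (P_br x y)"
proof -
  have "P_br (P_scale c x) y = P_scale c (P_br x y) \<and> P_br x (P_scale c y) = P_scale c (P_br x y)"
  proof (induction x rule: poly_mapping_additive_induct)
    case (single p a)
    show ?case
      by (induction y rule: poly_mapping_additive_induct)
        (simp_all add: P_add P_single wbr_scale)
  qed (simp add: P_add)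
  then show "P_br (P_scale c x) y = P_scale c (P_br x y)" "P_br x (P_scale c y) = P_scale c (P_br x y)"
    by auto
qed

lemma P_der_scale: "P_der (P_scale c x) = P_scale c (P_der x)"
  by (induction x rule: poly_mapping_additive_induct) (simp_all add: P_add P_single D.scale)

lemma P_mul_assoc: "P_mul (P_mul x y) z = P_mul x (P_mul y z)"
proof (induction x rule: poly_mapping_additive_induct)
  case (single p a)
  show ?case
  proof (induction y rule: poly_mapping_additive_induct)
    case (single q b)
    show ?case
      by (induction z rule: poly_mapping_additive_induct)
        (simp_all add: P_add P_single mult_assoc algebra_simps)
  qed (simp add: P_add)
qed (simp add: P_add)

lemma P_mul_comm: "P_mul x y = P_mul y x"
proof (induction x rule: poly_mapping_additive_induct)
  case (single p a)
  show ?case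
    by (induction y rule: poly_mapping_additive_induct)
      (simp_all add: P_add P_single mult_comm[of a] algebra_simps)
qed (simp add: P_add)

lemma P_br_antisym: "P_br y x = - P_br x y"
proof (induction x rule: poly_mapping_additive_induct)
  case (single p a)
  show ?case
    by (induction y rule: poly_mapping_additive_induct)
      (simp_all add: P_add P_single wbr_antisym[of _ _ _ a] single_uminus add.commute)
qed (simp add: P_add)

text \<open>
  Being alternating is not an additive condition, but antisymmetry cancels the cross terms in the
  induction.
\<close>

lemma P_br_alternating: "P_br x x = 0"
proof (induction x rule: poly_mapping_additive_induct)
  case (single p a)
  show ?case by (simp add: P_single wbr_def lie.alternating mult_comm)
next
  case (add x y)
  then show ?case by (simp add: P_add P_br_antisym[of y x])
qed

lemma P_br_jacobi: "P_br x (P_br y z) + P_br y (P_br z x) + P_br z (P_br x y) = 0"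
proof -
  \<comment> \<open>The Jacobiator as a triadditive map.\<close>
  define J where "J x y z = P_br x (P_br y z) + P_br y (P_br z x) + P_br z (P_br x y)" for x y z
  have J_add: "J (x + x') y z = J x y z + J x' y z" "J x (y + y') z = J x y z + J x y' z"
    "J x y (z + z') = J x y z + J x y z'" for x x' y y' z z'
    by (simp_all add: J_def P_add algebra_simps)
  have "J x y z = 0"
  proof (induction x rule: poly_mapping_additive_induct)
    case (single p a)
    show ?case
    proof (induction y rule: poly_mapping_additive_induct)
      case (single q b)
      show ?case
      proof (induction z rule: poly_mapping_additive_induct)
        case (single r c)
        show ?case
          using wbr_jacobi[of "of_int p" "of_int q" "of_int r" a b c]
          by (simp add: J_def P_single ac_simps flip: single_add)
      qed (simp add: J_add)
    qed (simp add: J_add)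
  qed (simp add: J_add)
  then show ?thesis by (simp add: J_def)
qed

lemma P_leibniz: "P_br (P_mul x y) z = P_mul x (P_br y z) + P_mul (P_br x z) y"
proof (induction x rule: poly_mapping_additive_induct)
  case (single p a)
  show ?case
  proof (induction y rule: poly_mapping_additive_induct)
    case (single q b)
    show ?case
    proof (induction z rule: poly_mapping_additive_induct)
      case (single r c)
      have "wbr (of_int (p + q + 1)) (of_int r) (mul a b) c
          = mul a (wbr (of_int q) (of_int r) b c) + mul (wbr (of_int p) (of_int r) a c) b"
        using wbr_leibniz[of "of_int p" "of_int q" "of_int r" a b c] by simp
      then show ?case
        by (simp only: P_single ac_simps flip: single_add)
    qed (simp add: P_add ac_simps)
  qed (simp add: P_add ac_simps)
qed (simp add: P_add ac_simps)

lemma P_der_mul: "P_der (P_mul x y) = P_mul (P_der x) y + P_mul x (P_der y)"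
proof (induction x rule: poly_mapping_additive_induct)
  case (single p a)
  show ?case
    by (induction y rule: poly_mapping_additive_induct)
      (simp_all add: P_add P_single D_mul algebra_simps flip: single_add)
qed (simp add: P_add)

lemma P_der_br: "P_der (P_br x y) = P_br (P_der x) y + P_br x (P_der y)"
proof (induction x rule: poly_mapping_additive_induct)
  case (single p a)
  show ?case
    by (induction y rule: poly_mapping_additive_induct)
      (simp_all add: P_add P_single wbr_derivation algebra_simps flip: single_add)
qed (simp add: P_add)

lemma poissonization: "differential_poisson_algebra P_scale P_mul P_br P_der"
proof -
  interpret P: vector_space P_scale by (rule P_vector_space)
  show ?thesis
    by unfold_locales
      (rule P_mul_assoc P_mul_comm P_br_alternating P_br_jacobi P_leibniz
        | simp add: derivation_def Vector_Spaces.linear_iff P_vector_space P_add P_mul_scale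
            P_br_scale P_der_scale P_der_mul P_der_br)+
qed

theorem special_gd_algebra_derivation_product: "special_gd_algebra scale (\<lambda>x y. mul x (D y)) br"
proof (rule special_gd_algebraI[where \<phi> = "Poly_Mapping.single 0", OF _ poissonization])
  show "Vector_Spaces.linear scale P_scale (Poly_Mapping.single 0)"
    by (simp add: Vector_Spaces.linear_iff vector_space_axioms P_vector_space P_single single_add)
  show "inj (Poly_Mapping.single 0 :: 'v \<Rightarrow> int \<Rightarrow>\<^sub>0 'v)"
    by (rule inj_single)
qed (simp_all add: gd_algebra_derivation_product P_single wbr_def)

end

theorem proposition5p4:
  fixes scale :: "'k::{alg_closed_field, field_char_0} \<Rightarrow> 'a::ab_group_add \<Rightarrow> 'a"
    and mul br :: "'a \<Rightarrow> 'a \<Rightarrow> 'a" and D :: "'a \<Rightarrow> 'a" and Basis :: "'a set"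
  assumes "generalized_poisson_algebra scale mul br D"
    and "finite_dimensional_vector_space scale Basis"
  shows "special_gd_algebra scale (\<lambda>x y. mul x (D y)) br"
  using assms(1) by (rule generalized_poisson_algebra.special_gd_algebra_derivation_product)

end
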